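(* Let $\{A(t)\}_{t\ge0}$ be a discrete time chain of $N\times N$ row-stochastic matrices, and for $\tau\ge0$ let $c_\tau$ be the number of vertices of the limiting polytope $C_\tau$. Then $$\lim_{\tau\to\infty}c_\tau=\mathbf{rank}(A).$$ Consequently, there exists $t_0\ge0$ such that $c_\tau=\mathbf{rank}(A)$ for every $\tau\ge t_0$.
   Context: Time indices are non-negative integers. The state transition matrix of the chain is $\Phi(t,\tau)=A(t-1)\cdots A(\tau)$ for $t>\tau\ge0$, and $\Phi(t,t)=I$. For $t\ge\tau\ge0$, $C_{t,\tau}\subset\mathbb R^N$ is the convex hull of the columns of the transpose $\Phi'(t,\tau)$ (the rows of $\Phi(t,\tau)$). For fixed $\tau$ these polytopes are decreasing in $t$, and $C_\tau=\lim_{t\to\infty}C_{t,\tau}=\bigcap_{t\ge\tau}C_{t,\tau}$, a polytope with at most $N$ vertices (extreme points). Rank: for $\tau\ge0$, $\mathbf{null}_\tau(A)=\{v\in\mathbb R^N:\lim_{t\to\infty}\Phi(t,\tau)v=\mathbf 0_N\}$. Its dimension is non-increasing in $\tau$, hence eventually constant. $\mathbf{nullity}(A)=\lim_{\tau\to\infty}\dim(\mathbf{null}_\tau(A))$ and $\mathbf{rank}(A)=N-\mathbf{nullity}(A)$. *)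

theory Defs
  imports "HOL-Analysis.Analysis"
begin

definition row_stochastic :: "real ^ 'n ^ 'n \<Rightarrow> bool" where
  "row_stochastic M \<longleftrightarrow> (\<forall>i j. 0 \<le> M $ i $ j) \<and> (\<forall>i. (\<Sum>j\<in>UNIV. M $ i $ j) = 1)"

(* state_trans A t s = A (t - 1) ** ... ** A s for t > s, and mat 1 for t = s.
   The value mat 1 for t < s is a filler: only t \<ge> s is used below. *)
primrec state_trans :: "(nat \<Rightarrow> real ^ 'n ^ 'n) \<Rightarrow> nat \<Rightarrow> nat \<Rightarrow> real ^ 'n ^ 'n" where
  "state_trans A 0 s = mat 1"
| "state_trans A (Suc t) s = (if s \<le> t then A t ** state_trans A t s else mat 1)"

definition row_polytope :: "(nat \<Rightarrow> real ^ 'n ^ 'n) \<Rightarrow> nat \<Rightarrow> nat \<Rightarrow> (real ^ 'n) set" where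
  "row_polytope A t s = convex hull (columns (transpose (state_trans A t s)))"

definition limit_polytope :: "(nat \<Rightarrow> real ^ 'n ^ 'n) \<Rightarrow> nat \<Rightarrow> (real ^ 'n) set" where
  "limit_polytope A s = (\<Inter>t\<in>{s..}. row_polytope A t s)"

(* For row-stochastic A the set counted here has at most CARD('n) elements,
   so the convention card = 0 for infinite sets plays no role. *)
definition num_vertices :: "(nat \<Rightarrow> real ^ 'n ^ 'n) \<Rightarrow> nat \<Rightarrow> nat" where
  "num_vertices A s = card {x. x extreme_point_of limit_polytope A s}"

definition chain_null :: "(nat \<Rightarrow> real ^ 'n ^ 'n) \<Rightarrow> nat \<Rightarrow> (real ^ 'n) set" where
  "chain_null A s = {v. (\<lambda>t. state_trans A t s *v v) \<longlonglongrightarrow> 0}"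

(* The dimensions are non-increasing in s, so the limit (in the discrete space nat) exists
   and is the eventual value; it is at most CARD('n), so the subtraction in chain_rank
   does not truncate. *)
definition chain_nullity :: "(nat \<Rightarrow> real ^ 'n ^ 'n) \<Rightarrow> nat" where
  "chain_nullity A = lim (\<lambda>s. dim (chain_null A s))"

definition chain_rank :: "(nat \<Rightarrow> real ^ 'n ^ 'n) \<Rightarrow> nat" where
  "chain_rank A = CARD('n) - chain_nullity A"

end

theory Submission
  imports Defs
begin

text \<open>
  A vector is in the null space at time \<open>s\<close> iff it is orthogonal to \<open>C\<^sub>s\<close>, so the rank is the eventual
  value of the non-decreasing sequence \<open>dim C\<^sub>t\<close>, the dimension of the linear span of \<open>C\<^sub>t\<close>. A polytope
  has at least as many vertices as the dimension of its span, so it remains to bound the number of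
  vertices of \<open>C\<^sub>s\<close> by \<open>dim C\<^sub>t\<close> for large \<open>t\<close>. Every vertex \<open>v\<close> of \<open>C\<^sub>s\<close> is a convex combination of
  the rows of the transition matrix from \<open>s\<close> to \<open>t\<close>, with a weight vector \<open>w\<^sub>v\<close> in \<open>C\<^sub>t\<close>. As \<open>v\<close> is
  extreme and the rows approach \<open>C\<^sub>s\<close>, the weights \<open>w\<^sub>v\<close> concentrate on rows close to \<open>v\<close>. For distinct
  vertices they are therefore almost supported on disjoint sets, hence linearly independent.
\<close>

section \<open>The standard simplex and convex hulls of matrix rows\<close>

definition prob_vectors :: "(real ^ 'n) set" where
  "prob_vectors = {p. (\<forall>i. 0 \<le> p $ i) \<and> (\<Sum>i\<in>UNIV. p $ i) = 1}"

lemma convex_prob_vectors: "convex prob_vectors"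
proof (rule convexI)
  fix p q :: "real ^ 'n" and u v :: real
  assume "p \<in> prob_vectors" "q \<in> prob_vectors" "0 \<le> u" "0 \<le> v" "u + v = 1"
  then show "u *\<^sub>R p + v *\<^sub>R q \<in> prob_vectors"
    by (simp add: prob_vectors_def sum.distrib flip: sum_distrib_left)
qed

lemma compact_prob_vectors: "compact (prob_vectors :: (real ^ 'n) set)"
proof -
  have "norm p \<le> 1" if "p \<in> prob_vectors" for p :: "real ^ 'n"
    using that norm_le_l1_cart[of p] by (simp add: prob_vectors_def)
  then have "bounded (prob_vectors :: (real ^ 'n) set)"
    unfolding bounded_iff by blast
  moreover have "closed (prob_vectors :: (real ^ 'n) set)"
    unfolding prob_vectors_def
    by (intro closed_Collect_conj closed_Collect_all closed_Collect_le closed_Collect_eq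
        continuous_intros)
  ultimately show ?thesis
    by (simp add: compact_eq_bounded_closed)
qed

lemma vector_matrix_mult_sum_rows: "p v* M = (\<Sum>i\<in>UNIV. p $ i *\<^sub>R M $ i)"
  for p :: "real ^ 'm" and M :: "real ^ 'n ^ 'm"
  by (simp add: vector_matrix_mult_def vec_eq_iff mult.commute)

lemma row_stochastic_iff: "row_stochastic M \<longleftrightarrow> (\<forall>i. M $ i \<in> prob_vectors)"
  by (auto simp: row_stochastic_def prob_vectors_def)

lemma linear_vector_matrix_mult: "linear (\<lambda>p. p v* M)" for M :: "real ^ 'n ^ 'm"
  by (intro linearI) (simp_all add: vector_matrix_left_distrib scaleR_vector_matrix_assoc)

lemma prob_vectors_vector_matrix_mult:
  "row_stochastic M \<Longrightarrow> p \<in> prob_vectors \<Longrightarrow> p v* M \<in> prob_vectors"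
  unfolding vector_matrix_mult_sum_rows row_stochastic_iff
  by (intro convex_sum convex_prob_vectors) (auto simp: prob_vectors_def)

text \<open>The corners of the simplex map to the rows, and a linear image of a convex set is
  convex. Points of the hull can thus be handled through their weight vectors
  \<open>p\<close>.\<close>

lemma convex_hull_rows: "convex hull (rows M) = (\<lambda>p. p v* M) ` prob_vectors"
  for M :: "real ^ 'n ^ 'm"
proof
  have "rows M \<subseteq> (\<lambda>p. p v* M) ` prob_vectors"
  proof
    fix x assume "x \<in> rows M"
    then obtain i where x: "x = M $ i"
      by (auto simp: rows_def row_def)
    have "x = axis i 1 v* M"
      unfolding vector_matrix_mult_sum_rows x axis_def
      by (simp add: if_distrib[of "\<lambda>c. c *\<^sub>R _"] cong: if_cong)
    moreover have "axis i 1 \<in> prob_vectors"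
      by (simp add: prob_vectors_def axis_def)
    ultimately show "x \<in> (\<lambda>p. p v* M) ` prob_vectors"
      by blast
  qed
  then show "convex hull (rows M) \<subseteq> (\<lambda>p. p v* M) ` prob_vectors"
    by (intro hull_minimal convex_linear_image linear_vector_matrix_mult convex_prob_vectors)
  have "M $ i \<in> convex hull rows M" for i
    by (intro hull_inc) (auto simp: rows_def row_def)
  then show "(\<lambda>p. p v* M) ` prob_vectors \<subseteq> convex hull (rows M)"
    by (auto simp: vector_matrix_mult_sum_rows prob_vectors_def intro!: convex_sum)
qed

section \<open>Row polytopes and their nesting in time\<close>

lemma row_polytope_eq: "row_polytope A t s = (\<lambda>p. p v* state_trans A t s) ` prob_vectors"
  by (simp add: row_polytope_def convex_hull_rows)

lemma state_trans_row_in_row_polytope: "state_trans A t s $ i \<in> row_polytope A t s"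
  unfolding row_polytope_def columns_transpose
  by (intro hull_inc) (auto simp: rows_def row_def)

lemma compact_row_polytope: "compact (row_polytope A t s)"
  unfolding row_polytope_eq
  by (intro compact_continuous_image linear_continuous_on linear_vector_matrix_mult
      compact_prob_vectors linear_conv_bounded_linear[THEN iffD1])

lemma convex_row_polytope: "convex (row_polytope A t s)"
  by (simp add: row_polytope_def)

lemma state_trans_self [simp]: "state_trans A t t = mat 1"
  by (cases t) simp_all

lemma state_trans_compose:
  assumes "s \<le> r" "r \<le> t"
  shows "state_trans A t s = state_trans A t r ** state_trans A r s"
  using assms(2,1)
  by (induction t rule: dec_induct) (simp_all add: matrix_mul_assoc)

lemma row_stochastic_state_trans:
  fixes A :: "nat \<Rightarrow> real ^ 'n ^ 'n"
  assumes "\<And>t. row_stochastic (A t)"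
  shows "row_stochastic (state_trans A t s)"
proof (induction t)
  \<comment> \<open>The identity is the value not only at time 0 but at every time up to
    \<open>s\<close>, so the successor case needs it too.\<close>
  have one: "row_stochastic (mat 1 :: real ^ 'n ^ 'n)"
    by (simp add: row_stochastic_def mat_def)
  case 0
  show ?case using one by simp
  case (Suc t)
  have "(A t ** state_trans A t s) $ i = A t $ i v* state_trans A t s" for i
    by (simp add: matrix_matrix_mult_def vector_matrix_mult_def vec_eq_iff)
  then have "row_stochastic (A t ** state_trans A t s)"
    using Suc assms[of t]
    by (auto simp: row_stochastic_iff[of "A t"] row_stochastic_iff[of "A t ** _"]
        intro: prob_vectors_vector_matrix_mult)
  then show ?case using one by simp
qed

lemma row_polytope_compose:
  assumes "s \<le> r" "r \<le> t"
  shows "row_polytope A t s = (\<lambda>p. p v* state_trans A r s) ` row_polytope A t r"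
  by (simp add: row_polytope_eq image_image state_trans_compose[OF assms] vector_matrix_mul_assoc)

lemma row_polytope_subset_prob_vectors:
  assumes "\<And>t. row_stochastic (A t)"
  shows "row_polytope A t s \<subseteq> prob_vectors"
  unfolding row_polytope_eq
  by (auto intro: prob_vectors_vector_matrix_mult row_stochastic_state_trans assms)

text \<open>Both sides are images under the matrix from \<open>s\<close> to \<open>r\<close>: the
  right one of the whole simplex, the left one only of \<open>row_polytope A t r\<close>, which lies
  in the simplex.\<close>

lemma row_polytope_antimono:
  assumes "\<And>t. row_stochastic (A t)" "s \<le> r" "r \<le> t"
  shows "row_polytope A t s \<subseteq> row_polytope A r s"
  unfolding row_polytope_compose[OF assms(2,3)] row_polytope_eq[of A r s]
  by (intro image_mono row_polytope_subset_prob_vectors assms(1))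

section \<open>Limit polytopes and compactness\<close>

lemma limit_polytope_subset: "s \<le> t \<Longrightarrow> limit_polytope A s \<subseteq> row_polytope A t s"
  by (auto simp: limit_polytope_def)

lemma limit_polytope_subset_prob_vectors:
  "(\<And>t. row_stochastic (A t)) \<Longrightarrow> limit_polytope A s \<subseteq> prob_vectors"
  using limit_polytope_subset[of s s A] row_polytope_subset_prob_vectors[of A s s] by blast

lemma compact_limit_polytope: "compact (limit_polytope A s)"
  unfolding limit_polytope_def by (rule compact_Inter) (auto simp: compact_row_polytope)

lemma convex_limit_polytope: "convex (limit_polytope A s)"
  unfolding limit_polytope_def by (intro convex_INT convex_row_polytope)

text \<open>Nesting turns a nonempty intersection with \<open>F\<close> at arbitrarily late times
  into one at all times; Cantor's intersection theorem then gives a common point.\<close>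

lemma limit_polytope_meets_closed:
  assumes stoch: "\<And>t. row_stochastic (A t)" and F: "closed F"
    and ne: "\<And>t. s \<le> t \<Longrightarrow> \<exists>t'\<ge>t. row_polytope A t' s \<inter> F \<noteq> {}"
  shows "limit_polytope A s \<inter> F \<noteq> {}"
proof -
  have "(\<Inter>n. row_polytope A (s + n) s \<inter> F) \<noteq> {}"
  proof (rule compact_nest)
    fix n
    show "compact (row_polytope A (s + n) s \<inter> F)"
      by (intro compact_Int_closed compact_row_polytope F)
    obtain t' where "t' \<ge> s + n" "row_polytope A t' s \<inter> F \<noteq> {}"
      using ne[of "s + n"] by auto
    then show "row_polytope A (s + n) s \<inter> F \<noteq> {}"
      using row_polytope_antimono[of A s "s + n" t', OF stoch] by auto
  next
    fix m n :: nat assume "m \<le> n"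
    then show "row_polytope A (s + n) s \<inter> F \<subseteq> row_polytope A (s + m) s \<inter> F"
      using row_polytope_antimono[of A s "s + m" "s + n", OF stoch] by auto
  qed
  then obtain x where x: "x \<in> row_polytope A (s + n) s" "x \<in> F" for n
    by auto
  have "x \<in> limit_polytope A s"
    unfolding limit_polytope_def using x(1) by (metis INT_I atLeast_iff le_iff_add)
  with x(2) show ?thesis by blast
qed

text \<open>An image of an intersection may be smaller than the intersection of the images, so
  compactness is used: the fibre over \<open>x\<close> is closed and meets
  \<open>row_polytope A t r\<close> for every \<open>t\<close> from \<open>r\<close> on, hence it
  meets their intersection.\<close>

lemma limit_polytope_subset_image:
  assumes stoch: "\<And>t. row_stochastic (A t)" and "s \<le> r"
  shows "limit_polytope A s \<subseteq> (\<lambda>p. p v* state_trans A r s) ` limit_polytope A r"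
proof
  fix x assume x: "x \<in> limit_polytope A s"
  let ?F = "{p. p v* state_trans A r s = x}"
  have "closed ?F"
    by (intro closed_Collect_eq continuous_intros linear_continuous_on
        linear_conv_bounded_linear[THEN iffD1] linear_vector_matrix_mult)
  moreover have "row_polytope A t r \<inter> ?F \<noteq> {}" if "r \<le> t" for t
    using x limit_polytope_subset[of s t A] row_polytope_compose[of s r t A] \<open>s \<le> r\<close> that
    by fastforce
  ultimately have "limit_polytope A r \<inter> ?F \<noteq> {}"
    by (intro limit_polytope_meets_closed stoch) blast+
  then show "x \<in> (\<lambda>p. p v* state_trans A r s) ` limit_polytope A r"
    by blast
qed

section \<open>The null space as an orthogonal complement\<close>

text \<open>If \<open>state_trans A t s *v v\<close> tends to 0, then so do its averages with
  probability weights, and each \<open>x \<bullet> v\<close> is such an average for every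
  \<open>t\<close>. Conversely, a coordinate that does not tend to 0 yields rows with
  \<open>e \<le> \<bar>x \<bullet> v\<bar>\<close> at arbitrarily late times, and hence such a point
  in the limit polytope.\<close>

lemma chain_null_eq:
  assumes stoch: "\<And>t. row_stochastic (A t)"
  shows "chain_null A s = {v. \<forall>x\<in>limit_polytope A s. x \<bullet> v = 0}"
proof (intro set_eqI iffI)
  fix v assume "v \<in> chain_null A s"
  then have lim: "(\<lambda>t. norm (state_trans A t s *v v)) \<longlonglongrightarrow> 0"
    by (simp add: chain_null_def tendsto_norm_zero)
  have "x \<bullet> v = 0" if x: "x \<in> limit_polytope A s" for x
  proof -
    have "\<bar>x \<bullet> v\<bar> \<le> norm (state_trans A t s *v v)" if t: "s \<le> t" for t
    proof -
      obtain p where p: "p \<in> prob_vectors" "x = p v* state_trans A t s"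
        using limit_polytope_subset[OF t] x by (auto simp: row_polytope_eq)
      have "norm p \<le> 1"
        using p(1) norm_le_l1_cart[of p] by (simp add: prob_vectors_def)
      then have "\<bar>p \<bullet> (state_trans A t s *v v)\<bar> \<le> 1 * norm (state_trans A t s *v v)"
        by (intro order.trans[OF Cauchy_Schwarz_ineq2] mult_right_mono) auto
      then show ?thesis by (simp add: p dot_lmul_matrix)
    qed
    then have "\<bar>x \<bullet> v\<bar> \<le> 0"
      by (intro tendsto_lowerbound[OF lim]) (auto simp: eventually_sequentially)
    then show ?thesis by simp
  qed
  then show "v \<in> {v. \<forall>x\<in>limit_polytope A s. x \<bullet> v = 0}" by blast
next
  fix v assume "v \<in> {v. \<forall>x\<in>limit_polytope A s. x \<bullet> v = 0}"
  then have v: "x \<bullet> v = 0" if "x \<in> limit_polytope A s" for x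
    using that by blast
  have "(\<lambda>t. (state_trans A t s *v v) $ i) \<longlonglongrightarrow> 0" for i
  proof (rule tendstoI, rule ccontr)
    fix e :: real assume "e > 0"
      and nev: "\<not> (\<forall>\<^sub>F t in sequentially. dist ((state_trans A t s *v v) $ i) 0 < e)"
    have "closed {x. e \<le> \<bar>x \<bullet> v\<bar>}"
      by (intro closed_Collect_le continuous_intros)
    moreover have "\<exists>t'\<ge>t. row_polytope A t' s \<inter> {x. e \<le> \<bar>x \<bullet> v\<bar>} \<noteq> {}" for t
    proof -
      obtain t' where "t' \<ge> t" "e \<le> \<bar>(state_trans A t' s *v v) $ i\<bar>"
        using nev by (auto simp: eventually_sequentially not_less)
      then show ?thesis
        using state_trans_row_in_row_polytope[of A t' s i]
        by (auto simp: matrix_vector_mul_component)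
    qed
    ultimately have "limit_polytope A s \<inter> {x. e \<le> \<bar>x \<bullet> v\<bar>} \<noteq> {}"
      by (intro limit_polytope_meets_closed stoch) auto
    with v \<open>e > 0\<close> show False by fastforce
  qed
  then show "v \<in> chain_null A s"
    by (simp add: chain_null_def vec_tendstoI)
qed

text \<open>Orthogonality to a set is orthogonality to its span, so the dimension formula for
  complementary subspaces applies.\<close>

lemma dim_chain_null:
  fixes A :: "nat \<Rightarrow> real ^ 'n ^ 'n"
  assumes "\<And>t. row_stochastic (A t)"
  shows "dim (chain_null A s) + dim (limit_polytope A s) = CARD('n)"
proof -
  have "chain_null A s = {v \<in> UNIV. \<forall>x\<in>span (limit_polytope A s). orthogonal x v}"
    unfolding chain_null_eq[OF assms]
    by (auto simp: orthogonal_def inner_commute intro: span_base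
        orthogonal_to_span[unfolded orthogonal_def])
  then show ?thesis
    using dim_subspace_orthogonal_to_vectors[of "span (limit_polytope A s)" "UNIV :: (real ^ 'n) set"]
    by simp
qed

text \<open>A linear map cannot raise the dimension, and each limit polytope is covered by a linear
  image of every later one.\<close>

lemma dim_limit_polytope_mono:
  assumes "\<And>t. row_stochastic (A t)" "s \<le> r"
  shows "dim (limit_polytope A s) \<le> dim (limit_polytope A r)"
  using dim_subset[OF limit_polytope_subset_image[OF assms]]
    dim_image_le[OF linear_vector_matrix_mult] by (rule order.trans)

section \<open>Extreme points and concentration of weights\<close>

text \<open>Removing an extreme point leaves a convex set, so the normalised average of the terms
  with \<open>x j \<noteq> v\<close> differs from \<open>v\<close>. Yet cancelling the terms equal
  to \<open>v\<close> shows that this average is \<open>v\<close>.\<close>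

lemma extreme_point_convex_combination:
  assumes "v extreme_point_of C" "convex C" "finite I"
    and a: "\<And>i. i \<in> I \<Longrightarrow> 0 \<le> a i" "(\<Sum>i\<in>I. a i) = 1"
    and x: "\<And>i. i \<in> I \<Longrightarrow> x i \<in> C" "(\<Sum>i\<in>I. a i *\<^sub>R x i) = v"
    and i: "i \<in> I" "0 < a i"
  shows "x i = v"
proof (rule ccontr)
  assume ne: "x i \<noteq> v"
  let ?J = "{j \<in> I. x j \<noteq> v}"
  define m where "m = (\<Sum>j\<in>?J. a j)"
  have "a i \<le> m"
    unfolding m_def using i ne a \<open>finite I\<close> by (intro member_le_sum) auto
  with i have m: "m > 0" by simp
  have "convex (C - {v})"
    using assms(1,2) extreme_point_of_stillconvex by blast
  then have "(\<Sum>j\<in>?J. (a j / m) *\<^sub>R x j) \<in> C - {v}"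
    using \<open>finite I\<close> a x m
    by (intro convex_sum) (auto simp: m_def simp flip: sum_divide_distrib)
  moreover have "(\<Sum>j\<in>?J. (a j / m) *\<^sub>R x j) = v"
  proof -
    have split: "(\<Sum>j\<in>I. f j) = (\<Sum>j\<in>?J. f j) + (\<Sum>j\<in>{j \<in> I. x j = v}. f j)"
      for f :: "'b \<Rightarrow> 'c::comm_monoid_add"
      using \<open>finite I\<close> by (subst sum.union_disjoint[symmetric]) (auto intro: sum.cong)
    have "v = (\<Sum>j\<in>?J. a j *\<^sub>R x j) + (\<Sum>j\<in>{j \<in> I. x j = v}. a j) *\<^sub>R v"
      using x(2) split[of "\<lambda>j. a j *\<^sub>R x j"] by (simp add: scaleR_left.sum)
    moreover have "(\<Sum>j\<in>{j \<in> I. x j = v}. a j) = 1 - m"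
      using a(2) split[of a] by (simp add: m_def)
    ultimately have "(\<Sum>j\<in>?J. a j *\<^sub>R x j) = m *\<^sub>R v"
      by (simp add: algebra_simps)
    moreover have "(\<Sum>j\<in>?J. (a j / m) *\<^sub>R x j) = (1 / m) *\<^sub>R (\<Sum>j\<in>?J. a j *\<^sub>R x j)"
      by (simp add: scaleR_sum_right)
    ultimately show ?thesis using m by simp
  qed
  ultimately show False by simp
qed

text \<open>Provides the compact space in which the transition matrices vary in the concentration
  argument.\<close>

lemma compact_matrices_rows_in:
  fixes K :: "(real ^ 'n) set"
  assumes "compact K"
  shows "compact {M :: real ^ 'n ^ 'm. \<forall>i. M $ i \<in> K}"
proof -
  obtain B where B: "\<And>x. x \<in> K \<Longrightarrow> norm x \<le> B"
    using compact_imp_bounded[OF assms] by (auto simp: bounded_iff)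
  have "norm M \<le> (\<Sum>i\<in>(UNIV :: 'm set). B)" if "\<forall>i. M $ i \<in> K" for M :: "real ^ 'n ^ 'm"
  proof -
    have "norm M \<le> (\<Sum>i\<in>UNIV. norm (M $ i))"
      unfolding norm_vec_def by (intro L2_set_le_sum) auto
    also have "\<dots> \<le> (\<Sum>i\<in>(UNIV :: 'm set). B)"
      using that B by (intro sum_mono) auto
    finally show ?thesis .
  qed
  then have "bounded {M :: real ^ 'n ^ 'm. \<forall>i. M $ i \<in> K}"
    unfolding bounded_iff by blast
  moreover have "closed {M :: real ^ 'n ^ 'm. \<forall>i. M $ i \<in> K}"
    by (intro closed_Collect_all closed_vimage[unfolded vimage_def] compact_imp_closed assms
        continuous_intros)
  ultimately show ?thesis
    by (simp add: compact_eq_bounded_closed)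
qed

text \<open>Failure at arbitrarily late times would produce a limiting pair \<open>(p, M)\<close>
  whose rows lie in the limit polytope, with \<open>p v* M = v\<close> and weighted distance at
  least \<open>e\<close>. Extremeness of \<open>v\<close> makes every row of positive weight equal
  to \<open>v\<close>, so that distance is 0.\<close>

lemma extreme_point_weights_concentrate:
  fixes A :: "nat \<Rightarrow> real ^ 'n ^ 'n"
  assumes stoch: "\<And>t. row_stochastic (A t)"
    and v: "v extreme_point_of limit_polytope A s" and "e > 0"
  shows "\<forall>\<^sub>F t in sequentially. \<forall>p\<in>prob_vectors. p v* state_trans A t s = v \<longrightarrow>
    (\<Sum>i\<in>UNIV. p $ i * dist (state_trans A t s $ i) v) < e"
proof -
  \<comment> \<open>The matrix \<open>M\<close> is left free, with only its rows confined to the row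
    polytope, so that the sets \<open>F n\<close> are nested; fixing it to the transition matrix
    would lose this.\<close>
  define F where "F n = {(p :: real ^ 'n, M :: real ^ 'n ^ 'n). p v* M = v \<and> e \<le> (\<Sum>i\<in>UNIV. p $ i * dist (M $ i) v)} \<inter>
    (prob_vectors \<times> {M. \<forall>i. M $ i \<in> row_polytope A (s + n) s})" for n
  have mono: "F n \<subseteq> F m" if "m \<le> n" for m n
    using row_polytope_antimono[of A s "s + m" "s + n", OF stoch] that by (auto simp: F_def)
  have "compact (F n)" for n
    unfolding F_def vector_matrix_mult_sum_rows case_prod_unfold
    by (intro closed_Int_compact compact_Times compact_prob_vectors compact_matrices_rows_in
        compact_row_polytope closed_Collect_conj closed_Collect_eq closed_Collect_le continuous_intros)
  moreover have "\<Inter>(range F) = {}"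
  proof (rule ccontr)
    assume "\<Inter>(range F) \<noteq> {}"
    then obtain p M where pM: "(p, M) \<in> F n" for n by auto
    have M: "M $ i \<in> limit_polytope A s" for i
      unfolding limit_polytope_def
    proof
      fix t assume "t \<in> {s..}"
      then show "M $ i \<in> row_polytope A t s"
        using pM[of "t - s"] by (auto simp: F_def)
    qed
    have p: "\<And>i. 0 \<le> p $ i" "(\<Sum>i\<in>UNIV. p $ i) = 1" "(\<Sum>i\<in>UNIV. p $ i *\<^sub>R M $ i) = v"
      "e \<le> (\<Sum>i\<in>UNIV. p $ i * dist (M $ i) v)"
      using pM[of 0] by (auto simp: F_def prob_vectors_def vector_matrix_mult_sum_rows)
    have "p $ i * dist (M $ i) v = 0" for i
      using extreme_point_convex_combination[OF v convex_limit_polytope, of UNIV "($) p" "($) M" i]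
        p M by (cases "p $ i = 0") (auto simp: less_le)
    with p(4) \<open>e > 0\<close> show False by simp
  qed
  \<comment> \<open>A decreasing sequence of compact sets with empty intersection has an empty
    member.\<close>
  ultimately obtain n where n: "F n = {}"
    using compact_nest[of F] mono by metis
  show ?thesis
    unfolding eventually_sequentially
  proof (intro exI[of _ "s + n"] allI impI ballI)
    fix t p assume t: "s + n \<le> t" and p: "p \<in> prob_vectors" "p v* state_trans A t s = v"
    have "(p, state_trans A t s) \<notin> F (t - s)"
      using mono[of n "t - s"] n t by auto
    with t p show "(\<Sum>i\<in>UNIV. p $ i * dist (state_trans A t s $ i) v) < e"
      using state_trans_row_in_row_polytope[of A t s] by (auto simp: F_def)
  qed
qed

section \<open>Linear independence of the weight vectors\<close>

text \<open>Each equation bounds \<open>\<bar>c u\<bar>\<close> by \<eta> times the l1-norm of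
  \<open>c\<close>. Summing over \<open>V\<close> bounds that norm by a factor below 1 times itself,
  so it vanishes.\<close>

lemma near_identity_kernel_trivial:
  fixes G :: "'a \<Rightarrow> 'a \<Rightarrow> real"
  assumes "finite V" and "real (card V) * \<eta> < 1"
    and G: "\<And>u v. u \<in> V \<Longrightarrow> v \<in> V \<Longrightarrow> \<bar>G v u - of_bool (v = u)\<bar> \<le> \<eta>"
    and c: "\<And>u. u \<in> V \<Longrightarrow> (\<Sum>v\<in>V. c v * G v u) = 0"
    and "v \<in> V"
  shows "c v = 0"
proof -
  let ?S = "\<Sum>v\<in>V. \<bar>c v\<bar>"
  have "\<bar>c u\<bar> \<le> \<eta> * ?S" if u: "u \<in> V" for u
  proof -
    have "c u = (\<Sum>v\<in>V. c v * of_bool (v = u))"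
      using u \<open>finite V\<close> by (simp add: of_bool_def if_distrib cong: if_cong)
    then have "- c u = (\<Sum>v\<in>V. c v * (G v u - of_bool (v = u)))"
      using c[OF u] by (simp add: right_diff_distrib sum_subtractf)
    then have "\<bar>c u\<bar> = \<bar>\<Sum>v\<in>V. c v * (G v u - of_bool (v = u))\<bar>"
      by (metis abs_minus_cancel)
    also have "\<dots> \<le> (\<Sum>v\<in>V. \<bar>c v\<bar> * \<eta>)"
      using G[OF u] by (intro order.trans[OF sum_abs] sum_mono) (simp add: abs_mult mult_left_mono)
    finally show ?thesis by (simp add: sum_distrib_left mult.commute)
  qed
  then have "?S \<le> (\<Sum>u\<in>V. \<eta> * ?S)" by (intro sum_mono)
  then have "(1 - real (card V) * \<eta>) * ?S \<le> 0" by (simp add: algebra_simps)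
  moreover have "0 \<le> ?S" by (simp add: sum_nonneg)
  ultimately have "?S = 0"
    using \<open>real (card V) * \<eta> < 1\<close> by (simp add: mult_le_0_iff)
  then show ?thesis
    using \<open>finite V\<close> \<open>v \<in> V\<close> by (simp add: sum_nonneg_eq_0_iff)
qed

lemma finite_set_separated:
  fixes V :: "'a::metric_space set"
  assumes "finite V"
  obtains d where "d > 0" "\<And>u v. u \<in> V \<Longrightarrow> v \<in> V \<Longrightarrow> u \<noteq> v \<Longrightarrow> d \<le> dist u v"
proof -
  \<comment> \<open>The extra 1 keeps the minimum defined when \<open>V\<close> has at most one
    point.\<close>
  let ?D = "insert 1 {dist u v |u v. u \<in> V \<and> v \<in> V \<and> u \<noteq> v}"
  have fin: "finite ?D"
    by (rule finite.insertI, rule finite_subset[OF _ finite_imageI[OF finite_cartesian_product[OF assms assms],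
          of "\<lambda>(u, v). dist u v"]]) auto
  show thesis
  proof
    show "Min ?D > 0" using fin by (subst Min_gr_iff) auto
    show "Min ?D \<le> dist u v" if "u \<in> V" "v \<in> V" "u \<noteq> v" for u v
      using fin that by (intro Min_le) auto
  qed
qed

text \<open>Stated for finite sets of vertices because finiteness of the whole vertex set is itself
  derived from this bound.\<close>

lemma eventually_card_extreme_points_le_dim:
  fixes A :: "nat \<Rightarrow> real ^ 'n ^ 'n"
  assumes stoch: "\<And>t. row_stochastic (A t)"
    and V: "finite V" "V \<subseteq> {v. v extreme_point_of limit_polytope A s}"
  shows "\<forall>\<^sub>F t in sequentially. card V \<le> dim (limit_polytope A t)"
proof -
  obtain d where d: "d > 0" "\<And>u v. u \<in> V \<Longrightarrow> v \<in> V \<Longrightarrow> u \<noteq> v \<Longrightarrow> d \<le> dist u v"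
    using finite_set_separated[OF V(1)] by blast
  define \<eta> where "\<eta> = 1 / (real (card V) + 1)"
  have \<eta>: "\<eta> > 0" "real (card V) * \<eta> < 1"
    by (simp_all add: \<eta>_def)
  \<comment> \<open>The threshold is \<open>\<eta> * d\<close> because the bumps used below are
    Lipschitz with constant \<open>1 / d\<close>. Uniformity in \<open>p\<close> matters: the
    weights \<open>w\<close> are chosen only after \<open>t\<close>.\<close>
  have "\<forall>\<^sub>F t in sequentially. \<forall>v\<in>V. \<forall>p\<in>prob_vectors. p v* state_trans A t s = v \<longrightarrow>
      (\<Sum>i\<in>UNIV. p $ i * dist (state_trans A t s $ i) v) < \<eta> * d"
    using V d(1) \<eta>(1)
    by (intro eventually_ball_finite ballI extreme_point_weights_concentrate stoch) auto
  with eventually_ge_at_top[of s] show ?thesis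
  proof eventually_elim
    case (elim t)
    let ?\<Phi> = "state_trans A t s"
    have "\<forall>v\<in>V. \<exists>p\<in>limit_polytope A t. p v* ?\<Phi> = v"
      using limit_polytope_subset_image[OF stoch \<open>s \<le> t\<close>] V(2)
      by (fastforce simp: extreme_point_of_def)
    then obtain w where w: "\<And>v. v \<in> V \<Longrightarrow> w v \<in> limit_polytope A t" "\<And>v. v \<in> V \<Longrightarrow> w v v* ?\<Phi> = v"
      by metis
    have wp: "w v \<in> prob_vectors" if "v \<in> V" for v
      using w(1)[OF that] limit_polytope_subset_prob_vectors[of A, OF stoch] by blast
    have inj: "inj_on w V"
      by (rule inj_on_inverseI[of _ "\<lambda>p. p v* ?\<Phi>"]) (rule w(2))
    text \<open>Testing \<open>w v\<close> against bumps \<open>g u\<close> centred at the vertices gives a matrix close to the identity.\<close>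
    define g where "g u x = max 0 (1 - dist x u / d)" for u x :: "real ^ 'n"
    have g_V: "g u v = of_bool (v = u)" if "u \<in> V" "v \<in> V" for u v
      using d(1) d(2)[OF that(2,1)] that by (cases "v = u") (auto simp: g_def divide_simps)
    have g_lip: "\<bar>g u x - g u v\<bar> \<le> dist x v / d" for u x v
    proof -
      have "\<bar>dist x u / d - dist v u / d\<bar> \<le> dist x v / d"
        using d(1) abs_dist_diff_le[of x u v]
        by (simp add: dist_commute divide_right_mono flip: diff_divide_distrib)
      then show ?thesis unfolding g_def by linarith
    qed
    define G where "G v u = (\<Sum>i\<in>UNIV. w v $ i * g u (?\<Phi> $ i))" for v u
    have G: "\<bar>G v u - of_bool (v = u)\<bar> \<le> \<eta>" if uv: "u \<in> V" "v \<in> V" for u v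
    proof -
      have p: "\<And>i. 0 \<le> w v $ i" "(\<Sum>i\<in>UNIV. w v $ i) = 1"
        using wp[OF uv(2)] by (auto simp: prob_vectors_def)
      have "G v u - of_bool (v = u) = (\<Sum>i\<in>UNIV. w v $ i * (g u (?\<Phi> $ i) - g u v))"
        using p(2) g_V[OF uv]
        by (simp add: G_def right_diff_distrib sum_subtractf flip: sum_distrib_right)
      also have "\<bar>\<dots>\<bar> \<le> (\<Sum>i\<in>UNIV. w v $ i * (dist (?\<Phi> $ i) v / d))"
        using p(1) g_lip by (intro order.trans[OF sum_abs] sum_mono)
          (simp add: abs_mult mult_left_mono del: times_divide_eq_right)
      also have "\<dots> = (\<Sum>i\<in>UNIV. w v $ i * dist (?\<Phi> $ i) v) / d"
        by (simp add: sum_divide_distrib)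
      also have "\<dots> \<le> \<eta>"
        using elim(2) uv wp[OF uv(2)] w(2)[OF uv(2)] d(1) by (simp add: divide_simps less_imp_le)
      finally show ?thesis .
    qed
    have "independent (w ` V)"
      unfolding dependent_finite[OF finite_imageI[OF V(1)]]
    proof safe
      fix c v assume "(\<Sum>x\<in>w ` V. c x *\<^sub>R x) = 0" and v: "v \<in> V" and nz: "c (w v) \<noteq> 0"
      then have sum0: "(\<Sum>v\<in>V. c (w v) *\<^sub>R w v) = 0"
        by (simp add: sum.reindex[OF inj])
      \<comment> \<open>For fixed \<open>u\<close>, \<open>G v u\<close> is one linear functional
        applied to \<open>w v\<close>, so a linear relation among the weights passes to
        \<open>G\<close>.\<close>
      have "(\<Sum>v\<in>V. c (w v) * G v u) = 0" for u
      proof -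
        have "(\<Sum>v\<in>V. c (w v) * G v u) =
            (\<Sum>i\<in>UNIV. (\<Sum>v\<in>V. c (w v) *\<^sub>R w v) $ i * g u (?\<Phi> $ i))"
          unfolding G_def sum_distrib_left sum_component sum_distrib_right
          by (subst sum.swap) (simp add: mult.assoc)
        then show ?thesis by (simp add: sum0)
      qed
      then have "c (w v) = 0"
        using near_identity_kernel_trivial[OF V(1) \<eta>(2) G, of "\<lambda>v. c (w v)"] v by blast
      with nz show False by simp
    qed
    moreover have "w ` V \<subseteq> limit_polytope A t" using w(1) by blast
    ultimately have "card (w ` V) \<le> dim (limit_polytope A t)"
      by (intro independent_card_le_dim)
    then show ?case by (simp add: card_image[OF inj])
  qed
qed

section \<open>Counting vertices and passing to the limit\<close>

text \<open>One vertex more than the dimension of the ambient space would force a limit polytope of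
  too large a dimension.\<close>

lemma finite_extreme_points_limit_polytope:
  fixes A :: "nat \<Rightarrow> real ^ 'n ^ 'n"
  assumes "\<And>t. row_stochastic (A t)"
  shows "finite {v. v extreme_point_of limit_polytope A s}"
proof (rule ccontr)
  assume "infinite {v. v extreme_point_of limit_polytope A s}"
  then obtain V where V: "finite V" "card V = Suc (CARD('n))"
    "V \<subseteq> {v. v extreme_point_of limit_polytope A s}"
    using infinite_arbitrarily_large by blast
  have "\<forall>\<^sub>F t in sequentially. Suc (CARD('n)) \<le> dim (limit_polytope A t)"
    using eventually_card_extreme_points_le_dim[OF assms V(1,3)] V(2) by simp
  then obtain t where "Suc (CARD('n)) \<le> dim (limit_polytope A t)"
    by (auto simp: eventually_sequentially)
  then show False
    using dim_chain_null[of A t, OF assms] by simp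
qed

text \<open>By the Krein-Milman theorem in its finite-dimensional form, the vertices span the limit
  polytope.\<close>

lemma dim_limit_polytope_le_num_vertices:
  assumes "\<And>t. row_stochastic (A t)"
  shows "dim (limit_polytope A s) \<le> num_vertices A s"
proof -
  let ?E = "{v. v extreme_point_of limit_polytope A s}"
  have "limit_polytope A s = convex hull ?E"
    by (intro Krein_Milman_Minkowski compact_limit_polytope convex_limit_polytope)
  then have "limit_polytope A s \<subseteq> span ?E"
    using convex_hull_subset_span by metis
  then show ?thesis
    unfolding num_vertices_def
    by (intro dim_le_card finite_extreme_points_limit_polytope assms)
qed

lemma mono_bounded_nat_eventually_const:
  fixes f :: "nat \<Rightarrow> nat"
  assumes "mono f" "\<And>n. f n \<le> b"
  obtains r where "\<forall>\<^sub>F n in sequentially. f n = r" "\<And>n. f n \<le> r"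
proof -
  have fin: "finite (range f)"
    by (rule finite_subset[of _ "{..b}"]) (use assms(2) in auto)
  then have le: "f n \<le> Max (range f)" for n by simp
  have "Max (range f) \<in> range f"
    using fin by (intro Max_in) auto
  then obtain n0 where "f n0 = Max (range f)" by auto
  then have "f n = Max (range f)" if "n0 \<le> n" for n
    using monoD[OF assms(1) that] le[of n] by simp
  then show thesis
    using that[of "Max (range f)"] le by (auto simp: eventually_sequentially)
qed

theorem theorem9:
  fixes A :: "nat \<Rightarrow> real ^ 'n ^ 'n"
  assumes "\<And>t. row_stochastic (A t)"
  shows "(\<lambda>\<tau>. num_vertices A \<tau>) \<longlonglongrightarrow> chain_rank A
    \<and> (\<exists>t0. \<forall>\<tau>\<ge>t0. num_vertices A \<tau> = chain_rank A)"
proof -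
  let ?d = "\<lambda>s. dim (limit_polytope A s)"
  have null: "dim (chain_null A s) + ?d s = CARD('n)" for s
    by (rule dim_chain_null[OF assms])
  have "mono ?d"
    by (intro monoI dim_limit_polytope_mono assms)
  moreover have d_le: "?d s \<le> CARD('n)" for s
    using null[of s] by simp
  ultimately obtain r where r: "\<forall>\<^sub>F s in sequentially. ?d s = r" "\<And>s. ?d s \<le> r"
    using mono_bounded_nat_eventually_const[of ?d] by blast
  have "\<forall>\<^sub>F s in sequentially. dim (chain_null A s) = CARD('n) - r"
    using r(1)
  proof eventually_elim
    case (elim s)
    then show ?case using null[of s] by simp
  qed
  then have "chain_nullity A = CARD('n) - r"
    unfolding chain_nullity_def by (intro limI tendsto_eventually)
  \<comment> \<open>Ensures that subtracting twice from \<open>CARD('n)\<close> on natural numbers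
    returns \<open>r\<close>.\<close>
  moreover have "r \<le> CARD('n)"
    using eventually_happens'[OF sequentially_bot r(1)] d_le by blast
  ultimately have rank: "chain_rank A = r"
    by (simp add: chain_rank_def)
  \<comment> \<open>The upper bound holds at every \<open>s\<close>, by comparison with late
    \<open>t\<close>; only the lower bound has to wait until \<open>?d s\<close> reaches
    \<open>r\<close>.\<close>
  have le: "num_vertices A s \<le> r" for s
  proof -
    have "\<forall>\<^sub>F t in sequentially. num_vertices A s \<le> ?d t"
      unfolding num_vertices_def
      by (rule eventually_card_extreme_points_le_dim
          [OF assms finite_extreme_points_limit_polytope[OF assms] order.refl])
    then show ?thesis
      using r(2) by (auto simp: eventually_sequentially intro: order.trans)
  qed
  have "\<forall>\<^sub>F s in sequentially. num_vertices A s = chain_rank A"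
    using r(1)
  proof eventually_elim
    case (elim s)
    then show ?case
      using le[of s] dim_limit_polytope_le_num_vertices[of A s, OF assms] rank by simp
  qed
  then show ?thesis
    by (intro conjI tendsto_eventually) (simp_all add: eventually_sequentially)
qed

end
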